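(* Let $G$ be a group having a finite normal subgroup $L$ such that $G/L$ is hypercentral. Then the hypercenter $Z_\infty(G)$ of $G$ has finite index in $G$, and $$|G/Z_\infty(G)|\le |\mathrm{Aut}(L)|\cdot |Z(L)|,$$ where $Z(L)$ denotes the center of $L$.
   Context: The (transfinite) upper central series of a group $G$ is defined by $Z_0(G)=1$, $Z_{\alpha+1}(G)/Z_\alpha(G)=Z(G/Z_\alpha(G))$ for every ordinal $\alpha$, and $Z_\lambda(G)=\bigcup_{\alpha<\lambda}Z_\alpha(G)$ for $\lambda$ a limit ordinal. The hypercenter $Z_\infty(G)$ is the last term of this series, i.e. the term at which it stabilizes. A group is hypercentral if it coincides with its hypercenter. *)

theory Defs
  imports "HOL-Algebra.Coset" "HOL-Algebra.Bij"
begin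

unbundle cardinal_syntax

definition group_center :: "('a, 'b) monoid_scheme \<Rightarrow> 'a set" where
  "group_center G = {z \<in> carrier G. \<forall>x \<in> carrier G. z \<otimes>\<^bsub>G\<^esub> x = x \<otimes>\<^bsub>G\<^esub> z}"

text \<open>For a normal subgroup \<open>N\<close> of \<open>G\<close>, this is the subgroup \<open>M \<supseteq> N\<close> with \<open>M / N = Z(G / N)\<close>.\<close>

definition center_above :: "('a, 'b) monoid_scheme \<Rightarrow> 'a set \<Rightarrow> 'a set" where
  "center_above G N = {x \<in> carrier G. N #>\<^bsub>G\<^esub> x \<in> group_center (G Mod N)}"

text \<open>
  Ordinals are represented by the elements of the field of a well-order \<open>r\<close>: the element \<open>\<alpha>\<close>
  stands for the order type of \<open>underS r \<alpha>\<close>. The transfinite upper central series of \<open>G\<close>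
  indexed by \<open>r\<close> is defined by well-founded recursion along \<open>r\<close>;
  the lemmas \<open>upper_central_zero\<close>, \<open>upper_central_suc\<close> and \<open>upper_central_limit\<close> give the three cases.
\<close>

definition upper_central_step ::
    "('a, 'b) monoid_scheme \<Rightarrow> 'i rel \<Rightarrow> ('i \<Rightarrow> 'a set) \<Rightarrow> 'i \<Rightarrow> 'a set" where
  "upper_central_step G r Z \<alpha> =
     (if underS r \<alpha> = {} then {\<one>\<^bsub>G\<^esub>}
      else if \<exists>\<beta> \<in> underS r \<alpha>. \<alpha> = wo_rel.suc r {\<beta>}
        then center_above G (Z (THE \<beta>. \<beta> \<in> underS r \<alpha> \<and> \<alpha> = wo_rel.suc r {\<beta>}))
      else (\<Union>\<beta> \<in> underS r \<alpha>. Z \<beta>))"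

definition upper_central :: "('a, 'b) monoid_scheme \<Rightarrow> 'i rel \<Rightarrow> 'i \<Rightarrow> 'a set" where
  "upper_central G r = wo_rel.worec r (upper_central_step G r)"

text \<open>
  The hypercenter is the eventual value of the series. It suffices to index the series by the
  ordinals below the cardinal successor of \<open>|G|\<close>, since a strictly increasing chain of subsets
  of \<open>G\<close> cannot be that long; see
  \<open>upper_central_stabilizes\<close>, \<open>hypercenter_eqI\<close> and \<open>hypercenter_props\<close>.
\<close>

definition hypercenter :: "('a, 'b) monoid_scheme \<Rightarrow> 'a set" where
  "hypercenter G =
     (let r = cardSuc |carrier G| in
      THE H. \<exists>\<alpha> \<in> Field r. \<forall>\<beta>. (\<alpha>, \<beta>) \<in> r \<longrightarrow> upper_central G r \<beta> = H)"

definition hypercentral :: "('a, 'b) monoid_scheme \<Rightarrow> bool" where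
  "hypercentral G \<longleftrightarrow> hypercenter G = carrier G"

context wo_rel
begin

lemma pred_unique:
  assumes "\<beta> \<in> underS \<alpha>" "\<gamma> \<in> underS \<alpha>" "\<alpha> = suc {\<beta>}" "\<alpha> = suc {\<gamma>}"
  shows "\<beta> = \<gamma>"
proof (rule ccontr)
  assume ne: "\<beta> \<noteq> \<gamma>"
  have F: "\<beta> \<in> Field r" "\<gamma> \<in> Field r"
    using assms(1,2) by (auto simp: Order_Relation.underS_def Field_def)
  have key: False if "(b, c) \<in> r" "b \<noteq> c" "c \<in> underS \<alpha>" "\<alpha> = suc {b}" for b c
  proof -
    have "c \<in> AboveS {b}"
      using that by (auto simp: Order_Relation.AboveS_def Field_def)
    then have "(\<alpha>, c) \<in> r" using suc_least_AboveS that(4) by simp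
    with that(3) ANTISYM show False
      by (auto simp: Order_Relation.underS_def antisym_def)
  qed
  from TOTALS F have "(\<beta>, \<gamma>) \<in> r \<or> (\<gamma>, \<beta>) \<in> r" by blast
  with key assms ne show False by metis
qed

lemma adm_upper_central_step:
  fixes G :: "('g, 'm) monoid_scheme"
  shows "adm_wo (upper_central_step G r)"
  unfolding adm_wo_def
proof (intro allI impI)
  fix f g :: "'a \<Rightarrow> 'g set" and \<alpha>
  assume eq: "\<forall>y \<in> underS \<alpha>. f y = g y"
  show "upper_central_step G r f \<alpha> = upper_central_step G r g \<alpha>"
  proof (cases "\<exists>\<beta> \<in> underS \<alpha>. \<alpha> = suc {\<beta>}")
    case True
    then obtain \<beta> where b: "\<beta> \<in> underS \<alpha>" "\<alpha> = suc {\<beta>}" by blast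
    then have "(THE \<beta>. \<beta> \<in> underS \<alpha> \<and> \<alpha> = suc {\<beta>}) = \<beta>"
      using pred_unique by (intro the_equality) blast+
    then show ?thesis using eq b by (simp add: upper_central_step_def)
  next
    case False
    then show ?thesis using eq by (simp add: upper_central_step_def)
  qed
qed

lemma upper_central_rec:
  "upper_central G r \<alpha> = upper_central_step G r (upper_central G r) \<alpha>"
  using worec_fixpoint[OF adm_upper_central_step, of G] unfolding upper_central_def by metis

lemma upper_central_zero:
  "underS \<alpha> = {} \<Longrightarrow> upper_central G r \<alpha> = {\<one>\<^bsub>G\<^esub>}"
  by (subst upper_central_rec) (simp add: upper_central_step_def)

lemma upper_central_suc:
  assumes "\<beta> \<in> underS \<alpha>" "\<alpha> = suc {\<beta>}"
  shows "upper_central G r \<alpha> = center_above G (upper_central G r \<beta>)"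
proof -
  have "(THE \<beta>. \<beta> \<in> underS \<alpha> \<and> \<alpha> = suc {\<beta>}) = \<beta>"
    using assms pred_unique by (intro the_equality) blast+
  with assms show ?thesis
    by (subst upper_central_rec) (auto simp: upper_central_step_def)
qed

lemma upper_central_limit:
  assumes "underS \<alpha> \<noteq> {}" "\<And>\<beta>. \<beta> \<in> underS \<alpha> \<Longrightarrow> \<alpha> \<noteq> suc {\<beta>}"
  shows "upper_central G r \<alpha> = (\<Union>\<beta> \<in> underS \<alpha>. upper_central G r \<beta>)"
  using assms by (subst upper_central_rec) (auto simp: upper_central_step_def)

end

lemma (in group) center_above_iff:
  assumes "N \<lhd> G"
  shows "x \<in> center_above G N \<longleftrightarrow>
           x \<in> carrier G \<and> (\<forall>y \<in> carrier G. N #> (x \<otimes> y) = N #> (y \<otimes> x))"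
proof -
  interpret normal N G by fact
  show ?thesis
    by (auto simp: center_above_def group_center_def FactGroup_def RCOSETS_def rcos_sum)
qed

lemma (in group) center_above_superset:
  assumes "N \<lhd> G"
  shows "N \<subseteq> center_above G N"
proof
  fix x assume x: "x \<in> N"
  interpret normal N G by fact
  have xc: "x \<in> carrier G" using x by simp
  have Nx: "N #> x = N" using x rcos_const[OF is_group] by simp
  have "N #> (x \<otimes> y) = N #> (y \<otimes> x)" if y: "y \<in> carrier G" for y
  proof -
    have "N #> (x \<otimes> y) = (N #> \<one>) <#> (N #> y)"
      using y xc Nx by (simp add: rcos_sum[symmetric] subset)
    also have "\<dots> = (N #> y) <#> (N #> \<one>)"
      using y by (simp add: rcos_sum del: coset_mult_one)
    also have "\<dots> = N #> (y \<otimes> x)"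
      using y xc Nx by (simp add: rcos_sum[symmetric] subset)
    finally show ?thesis .
  qed
  with xc show "x \<in> center_above G N" by (simp add: center_above_iff[OF assms])
qed

lemma (in group) group_center_normal: "group_center G \<lhd> G"
proof (rule normal_invI)
  show "subgroup (group_center G) G"
  proof (rule subgroupI)
    show "group_center G \<subseteq> carrier G" by (auto simp: group_center_def)
    have "\<one> \<in> group_center G" by (simp add: group_center_def)
    then show "group_center G \<noteq> {}" by blast
  next
    fix a assume "a \<in> group_center G"
    then have a: "a \<in> carrier G" and com: "\<And>x. x \<in> carrier G \<Longrightarrow> a \<otimes> x = x \<otimes> a"
      by (auto simp: group_center_def)
    have "inv a \<otimes> x = x \<otimes> inv a" if x: "x \<in> carrier G" for x
    proof -
      have "inv a \<otimes> x = inv a \<otimes> (x \<otimes> a) \<otimes> inv a" using a x by (simp add: m_assoc)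
      also have "\<dots> = inv a \<otimes> (a \<otimes> x) \<otimes> inv a" using com[OF x] by simp
      also have "\<dots> = x \<otimes> inv a" using a x by (simp add: m_assoc[symmetric])
      finally show ?thesis .
    qed
    with a show "inv a \<in> group_center G" by (simp add: group_center_def)
  next
    fix a b assume "a \<in> group_center G" "b \<in> group_center G"
    then have a: "a \<in> carrier G" "\<And>x. x \<in> carrier G \<Longrightarrow> a \<otimes> x = x \<otimes> a"
      and b: "b \<in> carrier G" "\<And>x. x \<in> carrier G \<Longrightarrow> b \<otimes> x = x \<otimes> b"
      by (auto simp: group_center_def)
    have "a \<otimes> b \<otimes> x = x \<otimes> (a \<otimes> b)" if x: "x \<in> carrier G" for x
    proof -
      have "a \<otimes> b \<otimes> x = a \<otimes> (x \<otimes> b)" using a(1) b x by (simp add: m_assoc)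
      also have "\<dots> = a \<otimes> x \<otimes> b" using a(1) b(1) x by (simp add: m_assoc)
      also have "\<dots> = x \<otimes> a \<otimes> b" using a(2)[OF x] by simp
      also have "\<dots> = x \<otimes> (a \<otimes> b)" using a(1) b(1) x by (simp add: m_assoc)
      finally show ?thesis .
    qed
    with a(1) b(1) show "a \<otimes> b \<in> group_center G" by (simp add: group_center_def)
  qed
next
  fix x h assume x: "x \<in> carrier G" and h: "h \<in> group_center G"
  then have hc: "h \<in> carrier G" and com: "h \<otimes> x = x \<otimes> h" by (auto simp: group_center_def)
  have "x \<otimes> h \<otimes> inv x = h" using x hc com[symmetric] by (simp add: m_assoc)
  with h show "x \<otimes> h \<otimes> inv x \<in> group_center G" by simp
qed

lemma (in group) center_above_normal:
  assumes "N \<lhd> G"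
  shows "center_above G N \<lhd> G"
proof -
  interpret normal N G by fact
  interpret Q: group "G Mod N" by (rule factorgroup_is_group)
  interpret C: normal "group_center (G Mod N)" "G Mod N" by (rule Q.group_center_normal)
  interpret h: group_hom G "G Mod N" "(#>) N"
    by unfold_locales (rule r_coset_hom_Mod)
  have cen: "x \<in> center_above G N \<longleftrightarrow> x \<in> carrier G \<and> N #> x \<in> group_center (G Mod N)" for x
    by (simp add: center_above_def)
  show ?thesis
  proof (rule normal_invI)
    show "subgroup (center_above G N) G"
    proof (rule subgroupI)
      show "center_above G N \<subseteq> carrier G" by (auto simp: center_above_def)
      show "center_above G N \<noteq> {}"
        using center_above_superset[OF assms] subgroup.one_closed[OF subgroup_axioms] by blast
    next
      fix a assume "a \<in> center_above G N"
      then show "inv a \<in> center_above G N"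
        unfolding cen using C.m_inv_closed[of "N #> a"] h.hom_inv[of a] by simp
    next
      fix a b assume "a \<in> center_above G N" "b \<in> center_above G N"
      then show "a \<otimes> b \<in> center_above G N"
        unfolding cen using C.m_closed[of "N #> a" "N #> b"] h.hom_mult[of a b]
          monoid.m_closed[OF is_monoid, of a b] by simp
    qed
  next
    fix x g assume x: "x \<in> carrier G" and g: "g \<in> center_above G N"
    then have gc: "g \<in> carrier G" by (simp add: cen)
    have "N #> (x \<otimes> g \<otimes> inv x) =
        (N #> x) \<otimes>\<^bsub>G Mod N\<^esub> (N #> g) \<otimes>\<^bsub>G Mod N\<^esub> inv\<^bsub>G Mod N\<^esub> (N #> x)"
      using x gc h.hom_mult[of "x \<otimes> g" "inv x"] h.hom_mult[of x g] h.hom_inv[of x]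
        monoid.m_closed[OF is_monoid, of x g] by simp
    also have "\<dots> \<in> group_center (G Mod N)"
      using C.inv_op_closed2[OF h.hom_closed[OF x]] g by (simp add: cen)
    finally show "x \<otimes> g \<otimes> inv x \<in> center_above G N"
      using x gc by (simp add: cen)
  qed
qed

context
  fixes G :: "('a, 'b) monoid_scheme" (structure) and r :: "'i rel"
  assumes G: "group G" and r: "Well_order r"
begin

interpretation group G by (rule G)
interpretation wo_rel r by unfold_locales (rule r)

lemma upper_central_normal_mono:
  "upper_central G r \<alpha> \<lhd> G \<and> (\<forall>\<beta> \<in> underS \<alpha>. upper_central G r \<beta> \<subseteq> upper_central G r \<alpha>)"
proof (induction \<alpha> rule: well_order_induct)
  case (1 \<alpha>)
  let ?Z = "upper_central G r"
  have N: "?Z \<beta> \<lhd> G" if "\<beta> \<in> underS \<alpha>" for \<beta>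
    using 1 that by (auto simp: Order_Relation.underS_def)
  have M: "?Z \<gamma> \<subseteq> ?Z \<beta>" if "\<beta> \<in> underS \<alpha>" "(\<gamma>, \<beta>) \<in> r" for \<beta> \<gamma>
    using 1 that by (cases "\<gamma> = \<beta>") (auto simp: Order_Relation.underS_def)
  consider "underS \<alpha> = {}" | \<beta> where "\<beta> \<in> underS \<alpha>" "\<alpha> = suc {\<beta>}"
    | "underS \<alpha> \<noteq> {}" "\<And>\<beta>. \<beta> \<in> underS \<alpha> \<Longrightarrow> \<alpha> \<noteq> suc {\<beta>}" by blast
  then show ?case
  proof cases
    case 1
    then show ?thesis by (simp add: upper_central_zero one_is_normal)
  next
    case (2 \<beta>)
    have "?Z \<gamma> \<subseteq> ?Z \<alpha>" if g: "\<gamma> \<in> underS \<alpha>" for \<gamma>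
    proof -
      have "(\<gamma>, \<beta>) \<in> r"
      proof (rule ccontr)
        assume n: "(\<gamma>, \<beta>) \<notin> r"
        have "\<gamma> \<in> Field r" "\<beta> \<in> Field r"
          using g 2 by (auto simp: Order_Relation.underS_def Field_def)
        then have "\<gamma> \<in> AboveS {\<beta>}" using n TOTALS REFL
          by (auto simp: Order_Relation.AboveS_def refl_on_def)
        then have "(\<alpha>, \<gamma>) \<in> r" using suc_least_AboveS 2(2) by simp
        with g ANTISYM show False by (auto simp: Order_Relation.underS_def antisym_def)
      qed
      then have "?Z \<gamma> \<subseteq> ?Z \<beta>" by (rule M[OF 2(1)])
      also have "\<dots> \<subseteq> ?Z \<alpha>"
        unfolding upper_central_suc[OF 2, of G] by (rule center_above_superset[OF N[OF 2(1)]])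
      finally show ?thesis .
    qed
    moreover have "?Z \<alpha> \<lhd> G"
      unfolding upper_central_suc[OF 2, of G] by (rule center_above_normal[OF N[OF 2(1)]])
    ultimately show ?thesis by blast
  next
    case 3
    have eq: "?Z \<alpha> = (\<Union>\<beta> \<in> underS \<alpha>. ?Z \<beta>)" by (rule upper_central_limit[OF 3])
    have sg: "subgroup (?Z \<beta>) G" if "\<beta> \<in> underS \<alpha>" for \<beta>
      by (rule normal_imp_subgroup[OF N[OF that]])
    have "subgroup (?Z \<alpha>) G"
    proof (rule subgroupI)
      show "?Z \<alpha> \<subseteq> carrier G"
        unfolding eq by (rule UN_least) (rule subgroup.subset[OF sg])
      from 3(1) obtain \<beta> where "\<beta> \<in> underS \<alpha>" by blast
      then show "?Z \<alpha> \<noteq> {}" using eq subgroup.one_closed[OF sg] by blast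
    next
      fix a assume "a \<in> ?Z \<alpha>"
      then obtain \<beta> where b: "\<beta> \<in> underS \<alpha>" "a \<in> ?Z \<beta>" using eq by blast
      from subgroup.m_inv_closed[OF sg[OF b(1)] b(2)] b(1)
      show "inv a \<in> ?Z \<alpha>" using eq by blast
    next
      fix a b assume "a \<in> ?Z \<alpha>" "b \<in> ?Z \<alpha>"
      then obtain \<beta> \<gamma> where bg: "\<beta> \<in> underS \<alpha>" "a \<in> ?Z \<beta>" "\<gamma> \<in> underS \<alpha>" "b \<in> ?Z \<gamma>"
        using eq by blast
      then have "\<beta> \<in> Field r" "\<gamma> \<in> Field r"
        by (auto simp: Order_Relation.underS_def Field_def)
      then have "(\<beta>, \<gamma>) \<in> r \<or> (\<gamma>, \<beta>) \<in> r" using TOTALS by blast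
      then obtain \<delta> where d: "\<delta> \<in> underS \<alpha>" "a \<in> ?Z \<delta>" "b \<in> ?Z \<delta>"
        using bg M[OF bg(1)] M[OF bg(3)] by blast
      from subgroup.m_closed[OF sg[OF d(1)] d(2,3)] d(1)
      show "a \<otimes> b \<in> ?Z \<alpha>" using eq by blast
    qed
    moreover have "x \<otimes> h \<otimes> inv x \<in> ?Z \<alpha>" if x: "x \<in> carrier G" and h: "h \<in> ?Z \<alpha>" for x h
    proof -
      from h obtain \<beta> where b: "\<beta> \<in> underS \<alpha>" "h \<in> ?Z \<beta>" using eq by blast
      from normal_invE(2)[OF N[OF b(1)] x b(2)] b(1) show ?thesis using eq by blast
    qed
    ultimately have "?Z \<alpha> \<lhd> G" by (rule normal_invI)
    moreover have "?Z \<beta> \<subseteq> ?Z \<alpha>" if "\<beta> \<in> underS \<alpha>" for \<beta> using that eq by blast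
    ultimately show ?thesis by blast
  qed
qed

lemma upper_central_normal: "upper_central G r \<alpha> \<lhd> G"
  using upper_central_normal_mono by blast

lemma upper_central_mono: "(\<alpha>, \<beta>) \<in> r \<Longrightarrow> upper_central G r \<alpha> \<subseteq> upper_central G r \<beta>"
  using upper_central_normal_mono[of \<beta>] by (cases "\<alpha> = \<beta>") (auto simp: Order_Relation.underS_def)

lemma suc_props:
  assumes "(\<alpha>, \<beta>) \<in> r" "\<alpha> \<noteq> \<beta>"
  shows "\<alpha> \<in> underS (suc {\<alpha>})" "(suc {\<alpha>}, \<beta>) \<in> r"
proof -
  have F: "{\<alpha>} \<subseteq> Field r" and A: "\<beta> \<in> AboveS {\<alpha>}"
    using assms by (auto simp: Field_def Order_Relation.AboveS_def)
  then have A': "AboveS {\<alpha>} \<noteq> {}" by blast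
  show "(suc {\<alpha>}, \<beta>) \<in> r" by (rule suc_least_AboveS[OF A])
  show "\<alpha> \<in> underS (suc {\<alpha>})"
    using suc_greater[OF F A', of \<alpha>] by (auto simp: Order_Relation.underS_def)
qed

lemma center_above_subset_upper_central:
  assumes "(\<alpha>, \<beta>) \<in> r" "\<alpha> \<noteq> \<beta>"
  shows "center_above G (upper_central G r \<alpha>) \<subseteq> upper_central G r \<beta>"
  using upper_central_suc[OF suc_props(1)[OF assms] refl, of G]
    upper_central_mono[OF suc_props(2)[OF assms]] by simp

lemma upper_central_constant_from:
  assumes fp: "center_above G (upper_central G r \<alpha>) = upper_central G r \<alpha>"
    and "(\<alpha>, \<beta>) \<in> r"
  shows "upper_central G r \<beta> = upper_central G r \<alpha>"
  using assms(2)
proof (induction \<beta> rule: well_order_induct)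
  case (1 \<beta>)
  let ?Z = "upper_central G r"
  have IH: "?Z \<gamma> \<subseteq> ?Z \<alpha>" if g: "\<gamma> \<in> underS \<beta>" for \<gamma>
  proof (cases "(\<alpha>, \<gamma>) \<in> r")
    case True
    then show ?thesis using 1 g by (auto simp: Order_Relation.underS_def)
  next
    case False
    have "\<alpha> \<in> Field r" "\<gamma> \<in> Field r"
      using g 1(2) by (auto simp: Order_Relation.underS_def Field_def)
    then have "(\<gamma>, \<alpha>) \<in> r" using False TOTALS by blast
    then show ?thesis by (rule upper_central_mono)
  qed
  have "?Z \<beta> \<subseteq> ?Z \<alpha>" if ne: "\<alpha> \<noteq> \<beta>"
  proof -
    have au: "\<alpha> \<in> underS \<beta>" using 1(2) ne by (auto simp: Order_Relation.underS_def)
    show ?thesis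
    proof (cases "\<exists>\<gamma> \<in> underS \<beta>. \<beta> = suc {\<gamma>}")
      case True
      then obtain \<gamma> where g: "\<gamma> \<in> underS \<beta>" "\<beta> = suc {\<gamma>}" by blast
      have "(\<alpha>, \<gamma>) \<in> r"
      proof (rule ccontr)
        assume n: "(\<alpha>, \<gamma>) \<notin> r"
        have F: "\<alpha> \<in> Field r" "\<gamma> \<in> Field r"
          using g au by (auto simp: Order_Relation.underS_def Field_def)
        then have "(\<gamma>, \<alpha>) \<in> r" "\<gamma> \<noteq> \<alpha>" using n TOTALS REFL by (auto simp: refl_on_def)
        then have "(\<beta>, \<alpha>) \<in> r" using suc_props(2) g(2) by simp
        with au ANTISYM show False by (auto simp: Order_Relation.underS_def antisym_def)
      qed
      then have "?Z \<gamma> = ?Z \<alpha>" using IH[OF g(1)] upper_central_mono by blast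
      then show ?thesis using upper_central_suc[OF g, of G] fp by simp
    next
      case False
      then have "?Z \<beta> = (\<Union>\<gamma> \<in> underS \<beta>. ?Z \<gamma>)"
        using upper_central_limit[of \<beta> G] au by blast
      then show ?thesis using IH by blast
    qed
  qed
  then show ?case using upper_central_mono[OF 1(2)] by blast
qed

lemma upper_central_stabilizes:
  assumes card: "Card_order r" and less: "|carrier G| <o r"
  obtains \<alpha> where "\<alpha> \<in> Field r"
    "center_above G (upper_central G r \<alpha>) = upper_central G r \<alpha>"
    "\<And>\<beta>. (\<alpha>, \<beta>) \<in> r \<Longrightarrow> upper_central G r \<beta> = upper_central G r \<alpha>"
proof -
  let ?Z = "upper_central G r"
  have "\<exists>\<alpha> \<in> Field r. center_above G (?Z \<alpha>) = ?Z \<alpha>"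
  proof (rule ccontr)
    assume "\<not> ?thesis"
    then have "\<forall>\<alpha> \<in> Field r. \<exists>x. x \<in> center_above G (?Z \<alpha>) - ?Z \<alpha>"
      using center_above_superset[OF upper_central_normal] by fast
    from bchoice[OF this] obtain f
      where f: "\<forall>\<alpha> \<in> Field r. f \<alpha> \<in> center_above G (?Z \<alpha>) - ?Z \<alpha>" ..
    have key: "f \<alpha> \<noteq> f \<beta>" if "(\<alpha>, \<beta>) \<in> r" "\<alpha> \<noteq> \<beta>" for \<alpha> \<beta>
    proof -
      have "\<alpha> \<in> Field r" "\<beta> \<in> Field r" using that(1) by (auto simp: Field_def)
      then show ?thesis using bspec[OF f, of \<alpha>] bspec[OF f, of \<beta>]
        center_above_subset_upper_central[OF that] by auto
    qed
    have "inj_on f (Field r)"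
    proof (rule inj_onI, rule ccontr)
      fix \<alpha> \<beta> assume a: "\<alpha> \<in> Field r" "\<beta> \<in> Field r" "f \<alpha> = f \<beta>" "\<alpha> \<noteq> \<beta>"
      then have "(\<alpha>, \<beta>) \<in> r \<or> (\<beta>, \<alpha>) \<in> r" using TOTALS by blast
      with key[of \<alpha> \<beta>] key[of \<beta> \<alpha>] a(3,4) show False by auto
    qed
    moreover have "f \<alpha> \<in> carrier G" if "\<alpha> \<in> Field r" for \<alpha>
      using bspec[OF f that] by (simp add: center_above_def)
    ultimately have "|Field r| \<le>o |carrier G|" by (rule card_of_ordLeqI)
    then have "r \<le>o |carrier G|"
      by (rule ordIso_ordLeq_trans[OF ordIso_symmetric[OF card_of_Field_ordIso[OF card]]])
    with less show False using not_ordLess_ordLeq by blast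
  qed
  then obtain \<alpha> where a: "\<alpha> \<in> Field r" "center_above G (?Z \<alpha>) = ?Z \<alpha>" by blast
  show ?thesis by (rule that[OF a upper_central_constant_from[OF a(2)]])
qed

end

lemma hypercenter_eqI:
  fixes G :: "('a, 'b) monoid_scheme" and \<alpha> :: "'a set"
  defines "r \<equiv> cardSuc |carrier G|"
  assumes G: "group G" and a: "\<alpha> \<in> Field r"
    and fp: "center_above G (upper_central G r \<alpha>) = upper_central G r \<alpha>"
  shows "hypercenter G = upper_central G r \<alpha>"
proof -
  have r: "Well_order r"
    unfolding r_def by (intro cardSuc_Well_order card_of_Card_order)
  interpret wo_rel r by unfold_locales (rule r)
  have const: "upper_central G r \<beta> = upper_central G r \<alpha>" if "(\<alpha>, \<beta>) \<in> r" for \<beta>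
    using upper_central_constant_from[OF G r fp that] .
  show ?thesis
    unfolding hypercenter_def Let_def r_def[symmetric]
  proof (rule the_equality)
    show "\<exists>\<alpha>' \<in> Field r. \<forall>\<beta>. (\<alpha>', \<beta>) \<in> r \<longrightarrow> upper_central G r \<beta> = upper_central G r \<alpha>"
      using const by (intro bexI[OF _ a] allI impI)
  next
    fix H assume "\<exists>\<alpha>' \<in> Field r. \<forall>\<beta>. (\<alpha>', \<beta>) \<in> r \<longrightarrow> upper_central G r \<beta> = H"
    then obtain \<alpha>' where a': "\<alpha>' \<in> Field r" "\<And>\<beta>. (\<alpha>', \<beta>) \<in> r \<Longrightarrow> upper_central G r \<beta> = H" by blast
    have "(\<alpha>, \<alpha>) \<in> r" "(\<alpha>', \<alpha>') \<in> r"
      using a a'(1) REFL by (auto simp: refl_on_def)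
    moreover have "(\<alpha>, \<alpha>') \<in> r \<or> (\<alpha>', \<alpha>) \<in> r" using TOTALS a a'(1) by blast
    ultimately show "H = upper_central G r \<alpha>"
      using a'(2)[of \<alpha>] a'(2)[of \<alpha>'] const[of \<alpha>'] by auto
  qed
qed

lemma hypercenter_props:
  assumes G: "group G"
  shows "hypercenter G \<lhd> G" and "center_above G (hypercenter G) = hypercenter G"
proof -
  let ?r = "cardSuc |carrier G|"
  have r: "Well_order ?r" and c: "Card_order ?r" and l: "|carrier G| <o ?r"
    by (rule cardSuc_Well_order cardSuc_Card_order cardSuc_greater, rule card_of_Card_order)+
  obtain \<alpha> where a: "\<alpha> \<in> Field ?r"
      "center_above G (upper_central G ?r \<alpha>) = upper_central G ?r \<alpha>"
    by (rule upper_central_stabilizes[OF G r c l])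
  note eq = hypercenter_eqI[OF G a]
  show "hypercenter G \<lhd> G" unfolding eq by (rule upper_central_normal[OF G r])
  show "center_above G (hypercenter G) = hypercenter G" unfolding eq by (rule a(2))
qed

end

theory Submission
  imports Defs
begin

text \<open>
  Let \<open>Z\<close> be the hypercenter, \<open>C\<close> the centralizer of \<open>L\<close> and \<open>A = C \<inter> L\<close> the center of \<open>L\<close>.
  Since \<open>G / C\<close> embeds into the automorphism group of \<open>L\<close>, it suffices that \<open>C \<subseteq> AZ\<close>. In \<open>G / Z\<close>,
  which has trivial center, this is a vanishing statement for first cohomology: if \<open>x\<close>
  commutes with \<open>L\<close> and with a finite abelian normal subgroup \<open>E\<close> that commutes with \<open>L\<close>, and if
  all \<open>[g, x]\<close> lie in \<open>E\<close>, then \<open>x \<in> E\<close>. It is proved by induction on \<open>|E|\<close>, splitting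
  \<open>E\<close> by the endomorphism \<open>e \<mapsto> [e, y]\<close>, where \<open>y\<close> is central modulo the centralizer of \<open>E\<close>.
\<close>

definition commutator :: "('a, 'b) monoid_scheme \<Rightarrow> 'a \<Rightarrow> 'a \<Rightarrow> 'a" where
  "commutator G g x = g \<otimes>\<^bsub>G\<^esub> x \<otimes>\<^bsub>G\<^esub> inv\<^bsub>G\<^esub> g \<otimes>\<^bsub>G\<^esub> inv\<^bsub>G\<^esub> x"

definition centralizer :: "('a, 'b) monoid_scheme \<Rightarrow> 'a set \<Rightarrow> 'a set" where
  "centralizer G S = {g \<in> carrier G. \<forall>s \<in> S. g \<otimes>\<^bsub>G\<^esub> s = s \<otimes>\<^bsub>G\<^esub> g}"

text \<open>
  This is an ordinal-free form of hypercentrality of \<open>G / L\<close>: every sequence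
  \<open>x, [g\<^sub>1, x], [g\<^sub>2, [g\<^sub>1, x]], \<dots>\<close> reaches \<open>L\<close>. Unlike the series, it passes to images directly.
\<close>

definition hypercentral_over :: "('a, 'b) monoid_scheme \<Rightarrow> 'a set \<Rightarrow> bool" where
  "hypercentral_over G L \<longleftrightarrow> (\<forall>T \<subseteq> carrier G. T \<noteq> {} \<longrightarrow> T \<inter> L = {} \<longrightarrow>
     (\<exists>x \<in> T. \<forall>g \<in> carrier G. commutator G g x \<notin> T))"

lemma centralizerD:
  assumes "g \<in> centralizer G S"
  shows "g \<in> carrier G" "s \<in> S \<Longrightarrow> g \<otimes>\<^bsub>G\<^esub> s = s \<otimes>\<^bsub>G\<^esub> g"
  using assms by (auto simp: centralizer_def)

lemma centralizer_antimono: "S \<subseteq> T \<Longrightarrow> centralizer G T \<subseteq> centralizer G S"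
  by (auto simp: centralizer_def)

lemma subset_centralizer_commute:
  assumes "S \<subseteq> centralizer G T" "T \<subseteq> carrier G"
  shows "T \<subseteq> centralizer G S"
  using assms by (fastforce simp: centralizer_def)

lemma hypercentral_overD:
  assumes "hypercentral_over G L" "T \<subseteq> carrier G" "T \<inter> L = {}" "T \<noteq> {}"
  shows "\<exists>x \<in> T. \<forall>g \<in> carrier G. commutator G g x \<notin> T"
  using assms unfolding hypercentral_over_def by blast

section \<open>Commutator calculus and centralizers\<close>

context group
begin

lemma mult_inv_cancel [simp]:
  assumes "x \<in> carrier G" "y \<in> carrier G"
  shows "x \<otimes> (inv x \<otimes> y) = y" "inv x \<otimes> (x \<otimes> y) = y"
  using assms by (simp_all flip: m_assoc)

lemma commutator_closed [simp]:
  "g \<in> carrier G \<Longrightarrow> x \<in> carrier G \<Longrightarrow> commutator G g x \<in> carrier G"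
  by (simp add: commutator_def)

lemma conj_eq_commutator_mult:
  "g \<in> carrier G \<Longrightarrow> x \<in> carrier G \<Longrightarrow> g \<otimes> x \<otimes> inv g = commutator G g x \<otimes> x"
  by (simp add: commutator_def m_assoc)

lemma commutator_eq_one_iff:
  assumes "g \<in> carrier G" "x \<in> carrier G"
  shows "commutator G g x = \<one> \<longleftrightarrow> g \<otimes> x = x \<otimes> g"
proof -
  have "commutator G g x = (g \<otimes> x) \<otimes> inv (x \<otimes> g)"
    using assms by (simp add: commutator_def m_assoc inv_mult_group)
  then show ?thesis using assms by (simp add: inv_solve_right')
qed

lemma inv_commutator:
  "g \<in> carrier G \<Longrightarrow> x \<in> carrier G \<Longrightarrow> inv (commutator G g x) = commutator G x g"
  by (simp add: commutator_def m_assoc inv_mult_group)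

lemma conj_commutator:
  assumes "g \<in> carrier G" "a \<in> carrier G" "b \<in> carrier G"
  shows "g \<otimes> commutator G a b \<otimes> inv g = commutator G (g \<otimes> a \<otimes> inv g) (g \<otimes> b \<otimes> inv g)"
  using assms by (simp add: commutator_def m_assoc inv_mult_group)

lemma commutator_mult_left:
  assumes "a \<in> carrier G" "b \<in> carrier G" "c \<in> carrier G"
  shows "commutator G (a \<otimes> b) c = a \<otimes> commutator G b c \<otimes> inv a \<otimes> commutator G a c"
  using assms by (simp add: commutator_def m_assoc inv_mult_group)

lemma commutator_mult_right:
  assumes "a \<in> carrier G" "b \<in> carrier G" "c \<in> carrier G"
  shows "commutator G a (b \<otimes> c) = commutator G a b \<otimes> (b \<otimes> commutator G a c \<otimes> inv b)"
  using assms by (simp add: commutator_def m_assoc inv_mult_group)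

lemma conj_eq_self:
  assumes "k \<in> carrier G" "u \<in> carrier G" "k \<otimes> u = u \<otimes> k"
  shows "k \<otimes> u \<otimes> inv k = u"
  using assms by (simp add: m_assoc)

text \<open>Conjugation by \<open>g\<close> replaces \<open>y\<close> by
  \<open>k \<otimes> y\<close> with \<open>k = [g, y]\<close>. This rule removes the factor
  \<open>k\<close> from a commutator again, which is how commutator maps are shown to be compatible
  with conjugation.\<close>

lemma commutator_commuting_mult_right:
  assumes "u \<in> carrier G" "k \<in> carrier G" "y \<in> carrier G"
    and "k \<otimes> u = u \<otimes> k" "k \<otimes> commutator G u y = commutator G u y \<otimes> k"
  shows "commutator G u (k \<otimes> y) = commutator G u y"
  using assms(1-3) commutator_eq_one_iff[of u k] assms(4)
    conj_eq_self[OF assms(2) _ assms(5)]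
  by (simp add: commutator_mult_right)

lemma commutes_mult:
  assumes "k \<in> carrier G" "a \<in> carrier G" "b \<in> carrier G"
    and "k \<otimes> a = a \<otimes> k" "k \<otimes> b = b \<otimes> k"
  shows "k \<otimes> (a \<otimes> b) = (a \<otimes> b) \<otimes> k"
proof -
  have "k \<otimes> (a \<otimes> b) = a \<otimes> (k \<otimes> b)" using assms(1-4) by (simp flip: m_assoc)
  then show ?thesis using assms by (simp add: m_assoc)
qed

lemma commutes_inv:
  assumes "k \<in> carrier G" "a \<in> carrier G" "k \<otimes> a = a \<otimes> k"
  shows "k \<otimes> inv a = inv a \<otimes> k"
proof -
  have "inv a \<otimes> (k \<otimes> a) \<otimes> inv a = inv a \<otimes> (a \<otimes> k) \<otimes> inv a" using assms(3) by simp
  then show ?thesis using assms(1,2) by (simp add: m_assoc)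
qed

lemma conj_inv_cancel:
  assumes "g \<in> carrier G" "x \<in> carrier G"
  shows "g \<otimes> (inv g \<otimes> x \<otimes> g) \<otimes> inv g = x"
  using assms by (simp add: m_assoc)

lemma conj_mult:
  assumes "g \<in> carrier G" "a \<in> carrier G" "b \<in> carrier G"
  shows "g \<otimes> (a \<otimes> b) \<otimes> inv g = (g \<otimes> a \<otimes> inv g) \<otimes> (g \<otimes> b \<otimes> inv g)"
  using assms by (simp add: m_assoc)

lemma commutes_conj:
  assumes "g \<in> carrier G" "a \<in> carrier G" "b \<in> carrier G" "a \<otimes> b = b \<otimes> a"
  shows "(g \<otimes> a \<otimes> inv g) \<otimes> (g \<otimes> b \<otimes> inv g) = (g \<otimes> b \<otimes> inv g) \<otimes> (g \<otimes> a \<otimes> inv g)"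
  using conj_mult[of g a b] conj_mult[of g b a] assms by simp

lemma normal_conj:
  "N \<lhd> G \<Longrightarrow> g \<in> carrier G \<Longrightarrow> n \<in> N \<Longrightarrow> g \<otimes> n \<otimes> inv g \<in> N"
  by (rule normal_invE(2))

lemma commutator_normal:
  assumes "N \<lhd> G" "g \<in> carrier G" "n \<in> N"
  shows "commutator G g n \<in> N" "commutator G n g \<in> N"
proof -
  interpret normal N G by fact
  have n: "n \<in> carrier G" using assms(3) by simp
  show 1: "commutator G g n \<in> N"
    using normal_conj[OF assms] assms(3) by (simp add: commutator_def)
  show "commutator G n g \<in> N"
    using m_inv_closed[OF 1] assms(2) n by (simp add: inv_commutator)
qed

lemma centralizer_subgroup:
  assumes "S \<subseteq> carrier G"
  shows "subgroup (centralizer G S) G"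
proof (rule subgroupI)
  show "centralizer G S \<subseteq> carrier G" by (auto simp: centralizer_def)
  show "centralizer G S \<noteq> {}"
    using assms by (auto simp: centralizer_def subset_iff intro!: exI[of _ \<one>])
  show "inv a \<in> centralizer G S" if "a \<in> centralizer G S" for a
    using that assms commutes_inv by (fastforce simp: centralizer_def)
  show "a \<otimes> b \<in> centralizer G S" if "a \<in> centralizer G S" "b \<in> centralizer G S" for a b
    using that assms commutes_mult[of _ a b] by (fastforce simp: centralizer_def)
qed

lemma centralizer_normal:
  assumes "S \<lhd> G"
  shows "centralizer G S \<lhd> G"
proof (rule normal_invI)
  interpret S: normal S G by fact
  show "subgroup (centralizer G S) G" by (rule centralizer_subgroup[OF S.subset])
  fix g n assume g: "g \<in> carrier G" and n: "n \<in> centralizer G S"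
  then have nc: "n \<in> carrier G" by (simp add: centralizer_def)
  have "(g \<otimes> n \<otimes> inv g) \<otimes> s = s \<otimes> (g \<otimes> n \<otimes> inv g)" if s: "s \<in> S" for s
  proof -
    have "inv g \<otimes> s \<otimes> g \<in> S" using S.inv_op_closed1[OF g s] .
    then have "n \<otimes> (inv g \<otimes> s \<otimes> g) = (inv g \<otimes> s \<otimes> g) \<otimes> n"
      using n by (simp add: centralizer_def)
    from commutes_conj[OF g nc _ this] show ?thesis
      using g s by (simp add: conj_inv_cancel)
  qed
  then show "g \<otimes> n \<otimes> inv g \<in> centralizer G S" using g nc by (simp add: centralizer_def)
qed

section \<open>From the upper central series to sequences of commutators\<close>

text \<open>A counterexample \<open>T\<close> would contain, with each \<open>x\<close>, some
  \<open>[g, x]\<close>. Transfinite induction then shows that \<open>T\<close> misses every term of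
  the series: an \<open>x\<close> of \<open>T\<close> in a successor term would put some
  \<open>[g, x]\<close> of \<open>T\<close> into the preceding term. But some term is the whole
  group.\<close>

lemma hypercentral_over_one:
  assumes "hypercentral G"
  shows "hypercentral_over G {\<one>}"
  unfolding hypercentral_over_def
proof (intro allI impI, rule ccontr)
  fix T assume T: "T \<subseteq> carrier G" "T \<noteq> {}" "T \<inter> {\<one>} = {}"
    and "\<not> (\<exists>x\<in>T. \<forall>g\<in>carrier G. commutator G g x \<notin> T)"
  then have ex: "\<exists>g \<in> carrier G. commutator G g x \<in> T" if "x \<in> T" for x
    using that by blast
  let ?r = "cardSuc |carrier G|"
  have r: "Well_order ?r" and c: "Card_order ?r" and l: "|carrier G| <o ?r"
    by (rule cardSuc_Well_order cardSuc_Card_order cardSuc_greater, rule card_of_Card_order)+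
  interpret wo_rel ?r by unfold_locales (rule r)
  let ?Z = "upper_central G ?r"
  obtain \<alpha> where a: "\<alpha> \<in> Field ?r" "center_above G (?Z \<alpha>) = ?Z \<alpha>"
    by (rule upper_central_stabilizes[OF is_group r c l])
  have all: "?Z \<alpha> = carrier G"
    using hypercenter_eqI[OF is_group a] assms by (simp add: hypercentral_def)
  have "?Z \<beta> \<inter> T = {}" for \<beta>
  proof (induction \<beta> rule: well_order_induct)
    case (1 \<beta>)
    have IH: "?Z \<gamma> \<inter> T = {}" if "\<gamma> \<in> underS \<beta>" for \<gamma>
      using 1 that by (auto simp: Order_Relation.underS_def)
    consider "underS \<beta> = {}" | \<gamma> where "\<gamma> \<in> underS \<beta>" "\<beta> = suc {\<gamma>}"
      | "underS \<beta> \<noteq> {}" "\<And>\<gamma>. \<gamma> \<in> underS \<beta> \<Longrightarrow> \<beta> \<noteq> suc {\<gamma>}" by blast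
    then show ?case
    proof cases
      case 1
      from upper_central_zero[OF this, of G] show ?thesis using T by blast
    next
      case (2 \<gamma>)
      interpret N: normal "?Z \<gamma>" G by (rule upper_central_normal[OF is_group r])
      have False if x: "x \<in> ?Z \<beta>" "x \<in> T" for x
      proof -
        obtain g where g: "g \<in> carrier G" "commutator G g x \<in> T" using ex x by blast
        have xc: "x \<in> carrier G" using x T by blast
        have "?Z \<gamma> #> (x \<otimes> g) = ?Z \<gamma> #> (g \<otimes> x)"
          using x(1) g unfolding upper_central_suc[OF 2, of G]
          by (simp add: center_above_iff[OF N.normal_axioms])
        then have "g \<otimes> x \<in> ?Z \<gamma> #> (x \<otimes> g)"
          using rcos_self[of "g \<otimes> x" "?Z \<gamma>"] xc g N.subgroup_axioms by simp
        then have "g \<otimes> x \<otimes> inv (x \<otimes> g) \<in> ?Z \<gamma>"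
          using N.rcos_module_imp[OF is_group] xc g by simp
        then have "commutator G g x \<in> ?Z \<gamma>"
          using xc g by (simp add: commutator_def inv_mult_group m_assoc)
        then show False using IH[OF 2(1)] g by blast
      qed
      then show ?thesis by blast
    next
      case 3
      from upper_central_limit[OF this, of G] show ?thesis using IH by blast
    qed
  qed
  from this[of \<alpha>] all T show False by blast
qed

end

section \<open>Images and preimages under homomorphisms\<close>

context group_hom
begin

lemma hom_commutator:
  "g \<in> carrier G \<Longrightarrow> x \<in> carrier G \<Longrightarrow> h (commutator G g x) = commutator H (h g) (h x)"
  by (simp add: commutator_def)

text \<open>Pull \<open>T\<close> back along \<open>h\<close>. Surjectivity makes the preimage
  nonempty and every commutator with \<open>h x\<close> the image of a commutator with
  \<open>x\<close>.\<close>

lemma hypercentral_over_image: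
  assumes "hypercentral_over G L" "h ` carrier G = carrier H"
  shows "hypercentral_over H (h ` L)"
  unfolding hypercentral_over_def
proof (intro allI impI)
  fix T assume T: "T \<subseteq> carrier H" "T \<noteq> {}" "T \<inter> h ` L = {}"
  define T' where "T' = {x \<in> carrier G. h x \<in> T}"
  have T': "T' \<subseteq> carrier G" "T' \<inter> L = {}" using T(3) by (auto simp: T'_def)
  obtain y where "y \<in> T" using T(2) by blast
  moreover from this obtain z where "z \<in> carrier G" "y = h z"
    using T(1) unfolding assms(2)[symmetric] by blast
  ultimately have "T' \<noteq> {}" by (auto simp: T'_def)
  from hypercentral_overD[OF assms(1) T' this]
  obtain x where xT: "x \<in> T'" and x: "\<forall>g \<in> carrier G. commutator G g x \<notin> T'" ..
  have "x \<in> carrier G" using xT by (simp add: T'_def)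
  have "commutator H (h g) (h x) \<notin> T" if "g \<in> carrier G" for g
    using bspec[OF x that] hom_commutator[OF that \<open>x \<in> carrier G\<close>] that \<open>x \<in> carrier G\<close>
    by (simp add: T'_def)
  then have "\<forall>g \<in> carrier H. commutator H g (h x) \<notin> T"
    unfolding assms(2)[symmetric] by simp
  moreover have "h x \<in> T" using xT by (simp add: T'_def)
  ultimately show "\<exists>x\<in>T. \<forall>g\<in>carrier H. commutator H g x \<notin> T" ..
qed

text \<open>Push \<open>T\<close> forward: its image avoids \<open>\<one>\<close>, and if
  \<open>[g, x]\<close> were in \<open>T\<close>, its image would be in the image of
  \<open>T\<close>.\<close>

lemma hypercentral_over_kernel:
  assumes "hypercentral_over H {\<one>\<^bsub>H\<^esub>}"
  shows "hypercentral_over G (kernel G H h)"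
  unfolding hypercentral_over_def
proof (intro allI impI)
  fix T assume T: "T \<subseteq> carrier G" "T \<noteq> {}" "T \<inter> kernel G H h = {}"
  have 1: "h ` T \<subseteq> carrier H" "h ` T \<inter> {\<one>\<^bsub>H\<^esub>} = {}" "h ` T \<noteq> {}"
    using T by (auto simp: kernel_def)
  from hypercentral_overD[OF assms 1]
  obtain x where xT: "x \<in> T" and x: "\<forall>g \<in> carrier H. commutator H g (h x) \<notin> h ` T" by blast
  have "commutator G g x \<notin> T" if "g \<in> carrier G" for g
  proof -
    have "x \<in> carrier G" using T xT by blast
    then have "h (commutator G g x) \<notin> h ` T"
      using bspec[OF x hom_closed[OF that]] by (simp add: hom_commutator that)
    then show ?thesis by blast
  qed
  then show "\<exists>x\<in>T. \<forall>g\<in>carrier G. commutator G g x \<notin> T" using xT by blast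
qed

end

section \<open>Vanishing of first cohomology when the center is trivial\<close>

context group
begin

text \<open>
  The map \<open>n \<mapsto> [x, n]\<close> from the centralizer of \<open>E\<close> to \<open>E\<close> commutes with conjugation and kills
  the elements of \<open>L\<close>; a minimal nontrivial value of it would be central.
\<close>

lemma commutes_centralizer_of_hypercentral_over:
  assumes hyp: "hypercentral_over G L" and triv: "group_center G = {\<one>}"
    and E: "E \<lhd> G" "E \<subseteq> centralizer G E"
    and x: "x \<in> centralizer G E" "x \<in> centralizer G L"
    and xE: "\<And>g. g \<in> carrier G \<Longrightarrow> commutator G g x \<in> E"
    and n: "n \<in> centralizer G E"
  shows "n \<otimes> x = x \<otimes> n"
proof (rule ccontr)
  assume ne: "n \<otimes> x \<noteq> x \<otimes> n"
  interpret E: normal E G by (rule E(1))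
  interpret N: normal "centralizer G E" G by (rule centralizer_normal[OF E(1)])
  have xc: "x \<in> carrier G" by (rule centralizerD(1)[OF x(1)])
  \<comment> \<open>\<open>?T\<close> misses \<open>L\<close> because \<open>x\<close> centralizes
    \<open>L\<close>. For the chosen \<open>c\<close> in \<open>?T\<close>, all
    \<open>[g, c]\<close> stay in the normal subgroup \<open>centralizer G E\<close> but leave
    \<open>?T\<close>, so they commute with \<open>x\<close>.\<close>
  let ?T = "{n \<in> centralizer G E. n \<otimes> x \<noteq> x \<otimes> n}"
  have "?T \<subseteq> carrier G" by (auto dest: centralizerD(1))
  moreover have "?T \<inter> L = {}" using centralizerD(2)[OF x(2)] by auto
  moreover have "?T \<noteq> {}" using n ne by blast
  ultimately have "\<exists>c \<in> ?T. \<forall>g \<in> carrier G. commutator G g c \<notin> ?T"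
    by (rule hypercentral_overD[OF hyp])
  then obtain c
    where c: "c \<in> centralizer G E" "c \<otimes> x \<noteq> x \<otimes> c"
      and cT: "\<forall>g \<in> carrier G. commutator G g c \<notin> ?T" by blast
  have cc: "c \<in> carrier G" using c by simp
  define a where "a = commutator G x c"
  have aE: "a \<in> E"
    using E.m_inv_closed[OF xE[OF cc]] xc cc by (simp add: a_def inv_commutator)
  have ac: "a \<in> carrier G" using aE by simp
  \<comment> \<open>Conjugation by \<open>g\<close> turns \<open>x\<close> into
    \<open>e \<otimes> x\<close> and \<open>c\<close> into \<open>k \<otimes> c\<close>. Both new
    factors drop out of the commutator, so \<open>a\<close> is fixed; being central it is trivial,
    although \<open>c\<close> and \<open>x\<close> do not commute.\<close>
  have "a \<otimes> g = g \<otimes> a" if g: "g \<in> carrier G" for g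
  proof -
    define k where "k = commutator G g c"
    define e where "e = commutator G g x"
    have k: "k \<in> centralizer G E" unfolding k_def by (rule commutator_normal(1)[OF N.normal_axioms g c(1)])
    have kx: "k \<otimes> x = x \<otimes> k" using bspec[OF cT g] k unfolding k_def by simp
    have kc: "k \<in> carrier G" using k by simp
    have eE: "e \<in> E" unfolding e_def by (rule xE[OF g])
    then have ec: "e \<in> carrier G" by simp
    have ka: "k \<otimes> a = a \<otimes> k" by (rule centralizerD(2)[OF k aE])
    have ea: "e \<otimes> a = a \<otimes> e" by (rule centralizerD(2)[OF subsetD[OF E(2) eE] aE])
    have kce: "(k \<otimes> c) \<otimes> e = e \<otimes> (k \<otimes> c)"
      by (rule centralizerD(2)[OF N.m_closed[OF k c(1)] eE])
    have "g \<otimes> a \<otimes> inv g = commutator G (e \<otimes> x) (k \<otimes> c)"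
      unfolding a_def k_def e_def using conj_commutator[OF g xc cc]
      by (simp only: conj_eq_commutator_mult[OF g xc] conj_eq_commutator_mult[OF g cc])
    also have "\<dots> = e \<otimes> commutator G x (k \<otimes> c) \<otimes> inv e \<otimes> commutator G e (k \<otimes> c)"
      using ec xc kc cc by (simp add: commutator_mult_left)
    also have "commutator G x (k \<otimes> c) = a"
      unfolding a_def using xc kc cc kx ka
      by (intro commutator_commuting_mult_right) (auto simp: a_def)
    also have "commutator G e (k \<otimes> c) = \<one>"
      using commutator_eq_one_iff[of e "k \<otimes> c"] ec kc cc kce by simp
    also have "e \<otimes> a \<otimes> inv e = a" by (rule conj_eq_self[OF ec ac ea])
    finally have "g \<otimes> a \<otimes> inv g = a" using ac by simp
    then show ?thesis using g ac by (simp add: inv_solve_right')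
  qed
  then have "a \<in> group_center G" using ac by (simp add: group_center_def)
  then show False using triv c(2) commutator_eq_one_iff[OF xc cc] by (simp add: a_def)
qed

text \<open>The map sending \<open>g\<close> to \<open>[g, x]\<close> is a cocycle with values in
  the abelian group \<open>E\<close>. If it is the coboundary of some \<open>e\<close> in
  \<open>E\<close>, then \<open>inv e \<otimes> x\<close> is central, hence trivial; so membership
  of \<open>x\<close> in \<open>E\<close> says exactly that the cocycle is a coboundary.\<close>

lemma mem_of_commutators_mem:
  assumes hyp: "hypercentral_over G L" and L: "L \<subseteq> carrier G"
    and triv: "group_center G = {\<one>}"
    and "finite E" "E \<lhd> G" "E \<subseteq> centralizer G E" "E \<subseteq> centralizer G L"
    and "x \<in> centralizer G E" "x \<in> centralizer G L"
    and "\<And>g. g \<in> carrier G \<Longrightarrow> commutator G g x \<in> E"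
  shows "x \<in> E"
  using assms(4-)
proof (induction "card E" arbitrary: E x rule: less_induct)
  case less
  note E = less.prems(2) and EE = less.prems(3) and EL = less.prems(4)
    and xN = less.prems(5) and xL = less.prems(6) and xE = less.prems(7)
  let ?N = "centralizer G E"
  interpret E: normal E G by (rule E(1))
  interpret N: normal ?N G by (rule centralizer_normal[OF E])
  have CL: "subgroup (centralizer G L) G" by (rule centralizer_subgroup[OF L])
  have xc: "x \<in> carrier G" using xN by simp
  have LN: "L \<subseteq> ?N" by (rule subset_centralizer_commute[OF EL L])
  have com: "n \<otimes> e = e \<otimes> n" if "n \<in> ?N" "e \<in> E" for n e
    using that by (rule centralizerD(2))
  have Nx: "n \<otimes> x = x \<otimes> n" if "n \<in> ?N" for n
    by (rule commutes_centralizer_of_hypercentral_over[OF hyp triv E EE xN xL xE that])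
  show ?case
  proof (cases "?N = carrier G")
    \<comment> \<open>Here \<open>E\<close> is central, hence trivial, so all \<open>[g, x]\<close>
      are trivial and \<open>x\<close> itself is central.\<close>
    case True
    have "e = \<one>" if "e \<in> E" for e
    proof -
      have "e \<in> group_center G" using com[OF _ that] that True by (auto simp: group_center_def)
      then show ?thesis using triv by simp
    qed
    then have "commutator G g x = \<one>" if "g \<in> carrier G" for g using xE that by blast
    then have "x \<in> group_center G" using xc commutator_eq_one_iff by (simp add: group_center_def)
    then show ?thesis using triv by simp
  next
    case False
    then have "carrier G - ?N \<noteq> {}" using N.subset by blast
    \<comment> \<open>The complement of \<open>?N\<close> misses \<open>L\<close>, since
      \<open>L\<close> lies in \<open>?N\<close>. An element of it whose commutators all leave the
      complement is central modulo \<open>?N\<close>.\<close>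
    then obtain y where y: "y \<in> carrier G" "y \<notin> ?N"
      and gy: "\<And>g. g \<in> carrier G \<Longrightarrow> commutator G g y \<in> ?N"
      using hypercentral_overD[OF hyp, of "carrier G - ?N"] LN commutator_closed by blast
    let ?c = "\<lambda>u. commutator G u y"
    have cE: "?c e \<in> E" if "e \<in> E" for e by (rule commutator_normal[OF E y(1) that])
    \<comment> \<open>The argument \<open>u\<close> may lie outside \<open>E\<close>, as the rule is
      later applied to \<open>x\<close> and to a translate of \<open>x\<close>. Having
      \<open>?c u\<close> in \<open>E\<close> ensures that conjugation by \<open>e\<close> fixes
      it.\<close>
    have cmult: "?c (e \<otimes> u) = ?c u \<otimes> ?c e" if "e \<in> E" "u \<in> carrier G" "?c u \<in> E" for e u
    proof -
      have "e \<in> ?N" using that(1) EE by blast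
      then have "e \<otimes> ?c u \<otimes> inv e = ?c u" using com that y(1) by (intro conj_eq_self) auto
      then show ?thesis using that y(1) by (simp add: commutator_mult_left)
    qed
    \<comment> \<open>Equivariance of \<open>?c\<close>: conjugation by \<open>g\<close> multiplies
      \<open>y\<close> by \<open>[g, y]\<close>, which lies in \<open>?N\<close> and so commutes
      with the conjugate of \<open>u\<close> and with its value under \<open>?c\<close>.\<close>
    have conj_c: "g \<otimes> ?c u \<otimes> inv g = ?c (g \<otimes> u \<otimes> inv g)"
      if g: "g \<in> carrier G" and u: "u \<in> carrier G"
        and uE: "?c u \<in> E" and uN: "\<And>n. n \<in> ?N \<Longrightarrow> n \<otimes> (g \<otimes> u \<otimes> inv g) = (g \<otimes> u \<otimes> inv g) \<otimes> n"
        and guE: "?c (g \<otimes> u \<otimes> inv g) \<in> E" for g u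
    proof -
      let ?k = "commutator G g y"
      have "g \<otimes> ?c u \<otimes> inv g = commutator G (g \<otimes> u \<otimes> inv g) (?k \<otimes> y)"
        using conj_commutator[OF g u y(1)] by (simp only: conj_eq_commutator_mult[OF g y(1)])
      also have "\<dots> = ?c (g \<otimes> u \<otimes> inv g)"
        using g u y(1) uN[OF gy[OF g]] com[OF gy[OF g] guE]
        by (intro commutator_commuting_mult_right) auto
      finally show ?thesis .
    qed
    have conj_cE: "g \<otimes> ?c e \<otimes> inv g = ?c (g \<otimes> e \<otimes> inv g)" if "g \<in> carrier G" "e \<in> E" for g e
      by (rule conj_c) (use that cE com[OF _ normal_conj[OF E that]] normal_conj[OF E] in auto)
    \<comment> \<open>Kernel and image of \<open>e \<mapsto> [e, y]\<close>: the induction hypothesis for \<open>E1\<close> moves \<open>x\<close> by an element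
      of \<open>E\<close> to some \<open>u\<close> commuting with \<open>y\<close>, and for such \<open>u\<close> all \<open>[g, u]\<close> lie in \<open>E0\<close>.\<close>
    define E0 where "E0 = {e \<in> E. ?c e = \<one>}"
    define E1 where "E1 = ?c ` E"
    have c_hom: "?c (e \<otimes> f) = ?c e \<otimes> ?c f" if "e \<in> E" "f \<in> E" for e f
    proof -
      have "?c f \<otimes> ?c e = ?c e \<otimes> ?c f" by (rule com[OF subsetD[OF EE cE[OF that(2)]] cE[OF that(1)]])
      then show ?thesis using that cE cmult by simp
    qed
    have c_one: "?c \<one> = \<one>" using y(1) by (simp add: commutator_eq_one_iff)
    have c_inv: "?c (inv e) = inv (?c e)" if "e \<in> E" for e
      using c_hom[of "inv e" e] that y(1) c_one by (intro inv_equality[symmetric]) auto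
    have E0E: "E0 \<subseteq> E" and E1E: "E1 \<subseteq> E" using cE by (auto simp: E0_def E1_def)
    have E0: "E0 \<lhd> G"
    proof (rule normal_invI)
      show "subgroup E0 G"
      proof (rule subgroupI)
        show "E0 \<subseteq> carrier G" using E0E E.subset by blast
        show "E0 \<noteq> {}" using c_one E.one_closed unfolding E0_def by blast
      qed (auto simp: E0_def c_inv c_hom)
      show "g \<otimes> e \<otimes> inv g \<in> E0" if "g \<in> carrier G" "e \<in> E0" for g e
        using that conj_cE[of g e] normal_conj[OF E, of g e] by (simp add: E0_def)
    qed
    have E1: "E1 \<lhd> G"
    proof (rule normal_invI)
      show "subgroup E1 G"
      proof (rule subgroupI)
        show "E1 \<subseteq> carrier G" using E1E E.subset by blast
        show "E1 \<noteq> {}" using E.one_closed unfolding E1_def by blast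
      qed (auto simp: E1_def simp flip: c_inv c_hom)
      show "g \<otimes> e \<otimes> inv g \<in> E1" if "g \<in> carrier G" "e \<in> E1" for g e
        using that conj_cE[of g] normal_conj[OF E, of g] by (auto simp: E1_def)
    qed
    \<comment> \<open>The induction hypothesis for a proper subgroup \<open>D\<close> of
      \<open>E\<close>: the centralizing conditions on \<open>E\<close> pass to \<open>D\<close>,
      and \<open>?N\<close> centralizes \<open>D\<close>.\<close>
    have ind: "u \<in> D" if D: "D \<lhd> G" "D \<subset> E" and u: "u \<in> ?N" "u \<in> centralizer G L"
      and uD: "\<And>g. g \<in> carrier G \<Longrightarrow> commutator G g u \<in> D" for D u
    proof (rule less.hyps[OF _ _ D(1) _ _ _ u(2) uD])
      show "card D < card E" using D(2) less.prems(1) by (rule psubset_card_mono[rotated])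
      show "finite D" using D(2) less.prems(1) by (meson finite_subset psubset_imp_subset)
      show "D \<subseteq> centralizer G D" "D \<subseteq> centralizer G L" "u \<in> centralizer G D"
        using D(2) EE EL u(1) centralizer_antimono[of D E G] by auto
    qed
    have "E0 \<subset> E"
    proof -
      have "E0 \<noteq> E"
      proof
        assume "E0 = E"
        then have "y \<otimes> e = e \<otimes> y" if "e \<in> E" for e
          using that y(1) commutator_eq_one_iff[of e y] by (auto simp: E0_def)
        then have "y \<in> ?N" using y(1) unfolding centralizer_def by blast
        then show False using y(2) by simp
      qed
      then show ?thesis using E0E by blast
    qed
    have cxE: "?c x \<in> E"
      using E.m_inv_closed[OF xE[OF y(1)]] y(1) xc by (simp add: inv_commutator)
    \<comment> \<open>If \<open>E1\<close> is smaller than \<open>E\<close>, the induction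
      hypothesis applies to the element \<open>?c x\<close> of \<open>E\<close>, because
      equivariance gives \<open>[g, ?c x] = ?c [g, x]\<close>, an element of
      \<open>E1\<close>.\<close>
    have "?c x \<in> E1"
    proof (cases "E1 = E")
      case False
      show ?thesis
      proof (rule ind[OF E1])
        show "E1 \<subset> E" using False E1E by blast
        show "?c x \<in> ?N" "?c x \<in> centralizer G L" using cxE EE EL by auto
        fix g assume g: "g \<in> carrier G"
        let ?e = "commutator G g x"
        have eE: "?e \<in> E" by (rule xE[OF g])
        have eq: "g \<otimes> x \<otimes> inv g = ?e \<otimes> x" using g xc by (rule conj_eq_commutator_mult)
        have "g \<otimes> ?c x \<otimes> inv g = ?c (?e \<otimes> x)"
          unfolding eq[symmetric]
        proof (rule conj_c[OF g xc cxE])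
          show "n \<otimes> (g \<otimes> x \<otimes> inv g) = g \<otimes> x \<otimes> inv g \<otimes> n" if "n \<in> ?N" for n
            unfolding eq using that Nx com eE g xc by (intro commutes_mult) auto
          show "?c (g \<otimes> x \<otimes> inv g) \<in> E"
            unfolding eq using cmult[OF eE xc cxE] cxE cE[OF eE] by simp
        qed
        also have "\<dots> = ?c x \<otimes> ?c ?e" by (rule cmult[OF eE xc cxE])
        also have "\<dots> = ?c ?e \<otimes> ?c x" using com[of "?c x" "?c ?e"] cxE cE[OF eE] EE by auto
        finally have "commutator G g (?c x) \<otimes> ?c x = ?c ?e \<otimes> ?c x"
          using conj_eq_commutator_mult[OF g, of "?c x"] xc y(1) by simp
        then have "commutator G g (?c x) = ?c ?e" using g xc y(1) by simp
        then show "commutator G g (?c x) \<in> E1" using eE by (simp add: E1_def)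
      qed
    qed (use cxE in simp)
    then obtain e where e: "e \<in> E" "?c x = ?c e" by (auto simp: E1_def)
    have ec: "e \<in> carrier G" using e by simp
    have ieE: "inv e \<in> E" using e by simp
    define u where "u = inv e \<otimes> x"
    have uc: "u \<in> carrier G" using ec xc by (simp add: u_def)
    have cu: "?c u = \<one>"
    proof -
      have "?c u = ?c e \<otimes> ?c (inv e)" unfolding u_def using cmult[OF ieE xc cxE] e(2) by simp
      also have "\<dots> = \<one>" using c_inv[OF e(1)] ec y(1) by simp
      finally show ?thesis .
    qed
    have uN: "u \<in> ?N" unfolding u_def using ieE EE xN by blast
    have uL: "u \<in> centralizer G L"
      unfolding u_def using subgroup.m_closed[OF CL] ieE EL xL by blast
    have Nu: "n \<otimes> u = u \<otimes> n" if "n \<in> ?N" for n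
      unfolding u_def using that com[OF that ieE] Nx[OF that] ec xc by (intro commutes_mult) auto
    have "u \<in> E0"
    proof (rule ind[OF E0 \<open>E0 \<subset> E\<close> uN uL])
      fix g assume g: "g \<in> carrier G"
      let ?e = "commutator G g u"
      have eE: "?e \<in> E"
      proof -
        have "?e = commutator G g (inv e) \<otimes> (inv e \<otimes> commutator G g x \<otimes> inv (inv e))"
          unfolding u_def using g ec xc by (simp add: commutator_mult_right)
        also have "\<dots> \<in> E"
          using commutator_normal(1)[OF E g ieE] normal_conj[OF E _ xE[OF g], of "inv e"] ec by simp
        finally show ?thesis .
      qed
      have eq: "g \<otimes> u \<otimes> inv g = ?e \<otimes> u" using g uc by (rule conj_eq_commutator_mult)
      have m: "?c (?e \<otimes> u) = ?c ?e" using cmult[OF eE uc] cu g uc y(1) by simp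
      \<comment> \<open>Equivariance at \<open>u\<close>: the left side is trivial since
        \<open>?c u = \<one>\<close>, and the right side equals \<open>?c ?e\<close>. Hence
        \<open>?e\<close> lies in the kernel \<open>E0\<close>.\<close>
      have "g \<otimes> ?c u \<otimes> inv g = ?c (g \<otimes> u \<otimes> inv g)"
      proof (rule conj_c[OF g uc])
        show "n \<otimes> (g \<otimes> u \<otimes> inv g) = g \<otimes> u \<otimes> inv g \<otimes> n" if "n \<in> ?N" for n
          unfolding eq using that Nu com eE g uc by (intro commutes_mult) auto
        show "?c (g \<otimes> u \<otimes> inv g) \<in> E" unfolding eq m by (rule cE[OF eE])
      qed (simp add: cu)
      then have "?c ?e = \<one>" using g unfolding eq m cu by simp
      then show "?e \<in> E0" using eE by (simp add: E0_def)
    qed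
    then have "e \<otimes> u \<in> E" using e(1) E0E by blast
    then show ?thesis using ec xc by (simp add: u_def)
  qed
qed

end

section \<open>Conjugation on \<open>L\<close> and the quotient by the hypercenter\<close>

lemma finite_auto: "finite (carrier G) \<Longrightarrow> finite (auto G)"
proof (rule finite_subset)
  show "auto G \<subseteq> carrier G \<rightarrow>\<^sub>E carrier G"
    by (auto simp: auto_def Bij_def bij_betw_def PiE_def)
qed (simp add: finite_PiE)

context group
begin

text \<open>The restriction to \<open>L\<close> is there because members of \<open>auto\<close> are
  extensional functions.\<close>

lemma conj_restrict_auto:
  assumes "L \<lhd> G" "g \<in> carrier G"
  shows "(\<lambda>l \<in> L. g \<otimes> l \<otimes> inv g) \<in> auto (G\<lparr>carrier := L\<rparr>)"
proof -
  interpret normal L G by fact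
  have "bij_betw (\<lambda>l. g \<otimes> l \<otimes> inv g) L L"
  proof (rule bij_betw_byWitness[where f' = "\<lambda>l. inv g \<otimes> l \<otimes> g"])
    show "\<forall>l \<in> L. inv g \<otimes> (g \<otimes> l \<otimes> inv g) \<otimes> g = l" "\<forall>l \<in> L. g \<otimes> (inv g \<otimes> l \<otimes> g) \<otimes> inv g = l"
      using assms(2) by (auto simp: m_assoc)
  qed (use assms(2) inv_op_closed1 inv_op_closed2 in blast)+
  then have "bij_betw (\<lambda>l \<in> L. g \<otimes> l \<otimes> inv g) L L"
    by (simp cong: bij_betw_cong)
  then show ?thesis
    using assms(2) by (auto simp: auto_def Bij_def hom_def conj_mult inv_op_closed2)
qed

text \<open>This is the injectivity of the map from \<open>G / C\<close> to the automorphisms of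
  \<open>L\<close>, where \<open>C\<close> is the centralizer of \<open>L\<close>.\<close>

lemma centralizer_of_conj_restrict_eq:
  assumes "L \<subseteq> carrier G" "g \<in> carrier G" "t \<in> carrier G"
    and eq: "(\<lambda>l \<in> L. g \<otimes> l \<otimes> inv g) = (\<lambda>l \<in> L. t \<otimes> l \<otimes> inv t)"
  shows "inv t \<otimes> g \<in> centralizer G L"
proof -
  have "inv t \<otimes> g \<otimes> l = l \<otimes> (inv t \<otimes> g)" if l: "l \<in> L" for l
  proof -
    have lc: "l \<in> carrier G" using l assms(1) by blast
    have "g \<otimes> l \<otimes> inv g = t \<otimes> l \<otimes> inv t" using fun_cong[OF eq, of l] l by simp
    then have "inv t \<otimes> (g \<otimes> l \<otimes> inv g) \<otimes> g = inv t \<otimes> (t \<otimes> l \<otimes> inv t) \<otimes> g" by simp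
    then show ?thesis using assms(2,3) lc by (simp add: m_assoc)
  qed
  then show ?thesis using assms by (simp add: centralizer_def)
qed

text \<open>A coset central in the quotient has its representatives in
  \<open>center_above G (hypercenter G)\<close>, which is the hypercenter itself because the series
  has stabilized there.\<close>

lemma group_center_Mod_hypercenter:
  "group_center (G Mod hypercenter G) = {\<one>\<^bsub>G Mod hypercenter G\<^esub>}"
proof -
  interpret Z: normal "hypercenter G" G by (rule hypercenter_props(1)[OF is_group])
  interpret Q: group "G Mod hypercenter G" by (rule Z.factorgroup_is_group)
  have "z = hypercenter G" if z: "z \<in> group_center (G Mod hypercenter G)" for z
  proof -
    from z obtain x where x: "x \<in> carrier G" "z = hypercenter G #> x"
      by (auto simp: group_center_def carrier_FactGroup)
    then have "x \<in> center_above G (hypercenter G)" using z by (simp add: center_above_def)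
    then have "x \<in> hypercenter G" by (simp add: hypercenter_props(2)[OF is_group])
    then show ?thesis using x(2) Z.rcos_const[OF is_group] by simp
  qed
  moreover have "\<one>\<^bsub>G Mod hypercenter G\<^esub> \<in> group_center (G Mod hypercenter G)"
    by (rule subgroup.one_closed[OF normal_imp_subgroup[OF Q.group_center_normal]])
  ultimately show ?thesis by auto
qed

lemma hypercentral_over_of_Mod:
  assumes "L \<lhd> G" "hypercentral (G Mod L)"
  shows "hypercentral_over G L"
proof -
  interpret L: normal L G by fact
  interpret Q: group "G Mod L" by (rule L.factorgroup_is_group)
  interpret q: group_hom G "G Mod L" "(#>) L" by unfold_locales (rule L.r_coset_hom_Mod)
  have "kernel G (G Mod L) ((#>) L) = L"
    using L.rcos_const[OF is_group] rcos_self[OF _ L.subgroup_axioms] by (auto simp: kernel_def)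
  then show ?thesis
    using q.hypercentral_over_kernel[OF Q.hypercentral_over_one[OF assms(2)]] by simp
qed

end

section \<open>The centralizer of \<open>L\<close> in the quotient, and the count\<close>

text \<open>For the quotient by the hypercenter this says \<open>C \<subseteq> AZ\<close>.
  Cohomology vanishing is applied in \<open>H\<close> to the image of \<open>?A\<close>;
  hypercentrality over \<open>L\<close> supplies an exceptional \<open>x\<close> whose commutators
  are no longer exceptional.\<close>

lemma (in group_hom) image_centralizer_subset:
  assumes surj: "h ` carrier G = carrier H" and triv: "group_center H = {\<one>\<^bsub>H\<^esub>}"
    and L: "L \<lhd> G" "finite L" and hyp: "hypercentral_over G L"
  shows "h ` centralizer G L \<subseteq> h ` (centralizer G L \<inter> L)"
proof (rule ccontr)
  let ?A = "centralizer G L \<inter> L"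
  let ?T = "{x \<in> centralizer G L. h x \<notin> h ` ?A}"
  have LG: "L \<subseteq> carrier G" using L(1) by (rule normal_imp_subgroup[THEN subgroup.subset])
  have C: "centralizer G L \<lhd> G" by (rule G.centralizer_normal[OF L(1)])
  have A: "?A \<lhd> G" by (rule G.normal_subgroup_intersect[OF C L(1)])
  have image_comm: "h ` S \<subseteq> centralizer H (h ` T)" if ST: "S \<subseteq> centralizer G T" "T \<subseteq> carrier G" for S T
  proof
    fix y assume "y \<in> h ` S"
    then obtain s where s: "s \<in> centralizer G T" "y = h s" using ST(1) by (auto simp: subset_iff)
    have "h s \<otimes>\<^bsub>H\<^esub> h t = h t \<otimes>\<^bsub>H\<^esub> h s" if t: "t \<in> T" for t
      using arg_cong[OF centralizerD(2)[OF s(1) t], of h] centralizerD(1)[OF s(1)] t ST(2)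
      by (auto simp: subset_iff)
    then show "y \<in> centralizer H (h ` T)"
      using s centralizerD(1)[OF s(1)] by (auto simp: centralizer_def)
  qed
  assume "\<not> h ` centralizer G L \<subseteq> h ` ?A"
  then have "?T \<noteq> {}" by blast
  have "?T \<subseteq> carrier G" by (auto dest: centralizerD(1))
  moreover have "?T \<inter> L = {}" by blast
  ultimately have "\<exists>x \<in> ?T. \<forall>g \<in> carrier G. commutator G g x \<notin> ?T"
    using \<open>?T \<noteq> {}\<close> by (rule hypercentral_overD[OF hyp])
  \<comment> \<open>Each \<open>[g, x]\<close> stays in the normal subgroup
    \<open>centralizer G L\<close>, so its absence from \<open>?T\<close> means that its image lies
    in the image of \<open>?A\<close>.\<close>
  then obtain x where x: "x \<in> centralizer G L" "h x \<notin> h ` ?A"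
    and xT: "\<forall>g \<in> carrier G. commutator G g x \<notin> ?T" by blast
  have AC: "?A \<subseteq> centralizer G ?A" using centralizer_antimono[of ?A L G] by blast
  have xA: "x \<in> centralizer G ?A" using x(1) centralizer_antimono[of ?A L G] by blast
  have "h x \<in> h ` ?A"
  proof (rule H.mem_of_commutators_mem)
    show "hypercentral_over H (h ` L)" by (rule hypercentral_over_image[OF hyp surj])
    show "h ` L \<subseteq> carrier H" using LG by auto
    show "finite (h ` ?A)" using L(2) by simp
    show "h ` ?A \<lhd> H"
      by (rule normal.surj_hom_normal_subgroup[OF A group_hom_axioms surj])
    show "h ` ?A \<subseteq> centralizer H (h ` ?A)" by (rule image_comm[OF AC]) (use LG in blast)
    show "h ` ?A \<subseteq> centralizer H (h ` L)" by (rule image_comm[OF _ LG]) blast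
    show "h x \<in> centralizer H (h ` ?A)" using image_comm[of "{x}" ?A] xA LG by auto
    show "h x \<in> centralizer H (h ` L)" using image_comm[of "{x}" L] x(1) LG by auto
    fix g assume "g \<in> carrier H"
    then obtain g' where g': "g' \<in> carrier G" "g = h g'" unfolding surj[symmetric] by blast
    have "commutator G g' x \<in> centralizer G L" by (rule G.commutator_normal(1)[OF C g'(1) x(1)])
    then have "h (commutator G g' x) \<in> h ` ?A" using bspec[OF xT g'(1)] by simp
    then show "commutator H g (h x) \<in> h ` ?A"
      using g' centralizerD(1)[OF x(1)] by (simp add: hom_commutator)
  qed (rule triv)
  then show False using x(2) by simp
qed

text \<open>Write \<open>g\<close> as \<open>u\<close> times an element of the centralizer of
  \<open>L\<close>, where \<open>u\<close> is a fixed element inducing the same automorphism as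
  \<open>g\<close>. The second factor has the same image as some \<open>a\<close> in
  \<open>A\<close>, so the pairs of an automorphism and an element of \<open>A\<close> cover
  \<open>H\<close>.\<close>

lemma (in group_hom) card_image_bound:
  assumes surj: "h ` carrier G = carrier H" and L: "L \<lhd> G" "finite L"
    and C: "h ` centralizer G L \<subseteq> h ` A" and A: "A \<subseteq> carrier G" "finite A"
  shows "finite (carrier H) \<and> card (carrier H) \<le> card (auto (G\<lparr>carrier := L\<rparr>)) * card A"
proof -
  have LG: "L \<subseteq> carrier G" using L(1) by (rule normal_imp_subgroup[THEN subgroup.subset])
  let ?U = "auto (G\<lparr>carrier := L\<rparr>)"
  define \<kappa> where "\<kappa> g = (\<lambda>l \<in> L. g \<otimes>\<^bsub>G\<^esub> l \<otimes>\<^bsub>G\<^esub> inv\<^bsub>G\<^esub> g)" for g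
  \<comment> \<open>Picks one group element for each automorphism induced by conjugation. Its
    arbitrary values at other automorphisms do no harm, since only a covering of \<open>H\<close> is
    sought.\<close>
  define t where "t = inv_into (carrier G) \<kappa>"
  have fin: "finite (?U \<times> A)" using finite_auto[of "G\<lparr>carrier := L\<rparr>"] L(2) A(2) by simp
  have sub: "carrier H \<subseteq> (\<lambda>(s, a). h (t s) \<otimes>\<^bsub>H\<^esub> h a) ` (?U \<times> A)"
  proof
    fix y assume "y \<in> carrier H"
    then obtain g where g: "g \<in> carrier G" "y = h g" unfolding surj[symmetric] by blast
    define u where "u = t (\<kappa> g)"
    have "\<kappa> g \<in> \<kappa> ` carrier G" using g(1) by (rule imageI)
    then have u: "u \<in> carrier G" and eq: "\<kappa> g = \<kappa> u"
      by (simp_all add: u_def t_def inv_into_into f_inv_into_f)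
    have "inv\<^bsub>G\<^esub> u \<otimes>\<^bsub>G\<^esub> g \<in> centralizer G L"
      by (rule G.centralizer_of_conj_restrict_eq[OF LG g(1) u eq[unfolded \<kappa>_def]])
    then obtain a where a: "a \<in> A" "h (inv\<^bsub>G\<^esub> u \<otimes>\<^bsub>G\<^esub> g) = h a" using C by blast
    have "h u \<otimes>\<^bsub>H\<^esub> h a = y"
      using a(2)[symmetric] g u by simp
    moreover have "\<kappa> g \<in> ?U" unfolding \<kappa>_def by (rule G.conj_restrict_auto[OF L(1) g(1)])
    ultimately show "y \<in> (\<lambda>(s, a). h (t s) \<otimes>\<^bsub>H\<^esub> h a) ` (?U \<times> A)"
      using a(1) by (intro image_eqI[of _ _ "(\<kappa> g, a)"]) (simp_all add: u_def)
  qed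
  from finite_subset[OF sub] surj_card_le[OF fin sub] fin show ?thesis
    by (simp add: card_cartesian_product)
qed

theorem theorem1:
  fixes G :: "('a, 'b) monoid_scheme" (structure) and L :: "'a set"
  assumes "group G"
    and "L \<lhd> G" and "finite L"
    and "hypercentral (G Mod L)"
  shows "finite (carrier (G Mod hypercenter G)) \<and>
         order (G Mod hypercenter G)
           \<le> order (AutoGroup (G\<lparr>carrier := L\<rparr>)) * card (group_center (G\<lparr>carrier := L\<rparr>))"
proof -
  interpret group G by fact
  interpret Z: normal "hypercenter G" G by (rule hypercenter_props(1)[OF is_group])
  interpret Q: group "G Mod hypercenter G" by (rule Z.factorgroup_is_group)
  interpret q: group_hom G "G Mod hypercenter G" "(#>) (hypercenter G)"
    by unfold_locales (rule Z.r_coset_hom_Mod)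
  have LG: "L \<subseteq> carrier G" using assms(2) by (rule normal_imp_subgroup[THEN subgroup.subset])
  have surj: "(#>) (hypercenter G) ` carrier G = carrier (G Mod hypercenter G)"
    by (simp add: carrier_FactGroup)
  have C: "(#>) (hypercenter G) ` centralizer G L
      \<subseteq> (#>) (hypercenter G) ` (centralizer G L \<inter> L)"
    by (rule q.image_centralizer_subset[OF surj group_center_Mod_hypercenter assms(2,3)
          hypercentral_over_of_Mod[OF assms(2,4)]])
  have "centralizer G L \<inter> L = group_center (G\<lparr>carrier := L\<rparr>)"
    using LG by (auto simp: centralizer_def group_center_def)
  moreover have "centralizer G L \<inter> L \<subseteq> carrier G" "finite (centralizer G L \<inter> L)"
    using LG assms(3) by auto
  ultimately show ?thesis
    using q.card_image_bound[OF surj assms(2,3) C] by (simp add: order_def AutoGroup_def)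
qed

end
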